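(* Every vertex-edge random graph with $n\le 3$ vertices is a vertex random graph: for every $n\le3$, probability space $(\mathcal X,\mu)$ and symmetric measurable $\phi:\mathcal X\times\mathcal X\to[0,1]$, there exist a probability space $(\mathcal Y,\nu)$ and a symmetric measurable $\psi:\mathcal Y\times\mathcal Y\to\{0,1\}$ such that $\mathbf G(n,\mathcal X,\mu,\phi)$ and $\mathbf G(n,\mathcal Y,\nu,\psi)$ have the same distribution on $\mathcal G_n$.
   Context: For a positive integer $n$, $\mathcal G_n$ is the set of simple graphs with vertex set $[n]$. Given a probability space $(\mathcal X,\mu)$ and a symmetric measurable $\phi:\mathcal X\times\mathcal X\to[0,1]$, the vertex-edge random graph $\mathbf G(n,\mathcal X,\mu,\phi)$ is the random element of $\mathcal G_n$ obtained by drawing $X_1,\dots,X_n$ i.i.d. from $\mu$ and then, conditionally independently for each pair $i<j$, including edge $ij$ with probability $\phi(X_i,X_j)$. A vertex random graph is a vertex-edge random graph whose $\phi$ takes values in $\{0,1\}$. *)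

theory Defs
  imports "HOL-Probability.Probability"
begin

definition vertex_pairs :: "nat \<Rightarrow> (nat \<times> nat) set" where
  "vertex_pairs n = {(i, j). i \<in> {1..n} \<and> j \<in> {1..n} \<and> i < j}"

(* A simple graph with vertex set {1..n} is represented by its edge set, a set of unordered
   pairs of distinct vertices; simple_graphs n is the (finite) set of all of them. *)
definition simple_graphs :: "nat \<Rightarrow> nat set set set" where
  "simple_graphs n = {E. E \<subseteq> {{i, j} |i j. (i, j) \<in> vertex_pairs n}}"

(* b (i, j), for i < j, says whether the edge ij is present. *)
definition graph_of_indicators :: "nat \<Rightarrow> (nat \<times> nat \<Rightarrow> bool) \<Rightarrow> nat set set" where
  "graph_of_indicators n b = {{i, j} |i j. (i, j) \<in> vertex_pairs n \<and> b (i, j)}"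

(* Pi_pmf is the law of a family of independent variables indexed by vertex_pairs n;
   False is the irrelevant default value outside that index set. *)
definition independent_edges_graph :: "nat \<Rightarrow> (nat \<Rightarrow> nat \<Rightarrow> real) \<Rightarrow> nat set set measure" where
  "independent_edges_graph n p =
     distr (measure_pmf (Pi_pmf (vertex_pairs n) False (\<lambda>(i, j). bernoulli_pmf (p i j))))
       (count_space (simple_graphs n)) (graph_of_indicators n)"

(* The law of G(n, X, mu, phi) with (X, mu) = M: the Giry bind draws (X_1, ..., X_n) from the
   n-fold product of M and then the graph from its conditional law given (X_1, ..., X_n).
   Only the values of \<phi> on space M matter. *)
definition vertex_edge_random_graph ::
    "nat \<Rightarrow> 'a measure \<Rightarrow> ('a \<Rightarrow> 'a \<Rightarrow> real) \<Rightarrow> nat set set measure" where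
  "vertex_edge_random_graph n M \<phi> =
     (\<Pi>\<^sub>M i\<in>{1..n}. M) \<bind> (\<lambda>x. independent_edges_graph n (\<lambda>i j. \<phi> (x i) (x j)))"

definition symmetric_kernel :: "'a measure \<Rightarrow> ('a \<Rightarrow> 'a \<Rightarrow> real) \<Rightarrow> bool" where
  "symmetric_kernel M \<phi> \<longleftrightarrow>
     (\<lambda>(x, y). \<phi> x y) \<in> borel_measurable (M \<Otimes>\<^sub>M M) \<and>
     (\<forall>x\<in>space M. \<forall>y\<in>space M. \<phi> x y = \<phi> y x)"

end

theory Submission
  imports Defs
begin

text \<open>
  Attach to every vertex, besides its label \<open>X\<^sub>i\<close>, an independent uniform
  \<open>U\<^sub>i \<in> [0, 1)\<close>, and join \<open>i\<close> and \<open>j\<close> iff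
  \<open>frac (U\<^sub>i + U\<^sub>j) < \<phi> X\<^sub>i X\<^sub>j\<close>. On the circle, the map
  \<open>(u, v, w) \<mapsto> (u + v, u + w, v + w)\<close> is a surjective endomorphism of the 3-torus (its
  determinant is -2), so it preserves Haar measure: for three vertices the pairwise sums are again
  independent and uniform, and given the labels the edges are independent with the prescribed
  probabilities. Fewer vertices are handled by restricting from three.
\<close>

section \<open>Integration of functions of period one\<close>

lemma borel_measurable_frac [measurable]:
  "(frac :: real \<Rightarrow> real) \<in> borel_measurable borel"
  unfolding frac_def by measurable

lemma nn_integral_indicator_split:
  fixes h :: "real \<Rightarrow> ennreal"
  assumes [measurable]: "h \<in> borel_measurable borel" and "a \<le> b" "b \<le> c"
  shows "(\<integral>\<^sup>+t. h t * indicator {a..<c} t \<partial>lborel) =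
    (\<integral>\<^sup>+t. h t * indicator {a..<b} t \<partial>lborel) + (\<integral>\<^sup>+t. h t * indicator {b..<c} t \<partial>lborel)"
proof -
  have "(\<integral>\<^sup>+t. h t * indicator {a..<c} t \<partial>lborel) =
      (\<integral>\<^sup>+t. h t * indicator {a..<b} t + h t * indicator {b..<c} t \<partial>lborel)"
    using assms(2,3) by (intro nn_integral_cong) (auto split: split_indicator)
  then show ?thesis by (simp add: nn_integral_add)
qed

lemma nn_integral_indicator_translate:
  fixes h :: "real \<Rightarrow> ennreal"
  assumes [measurable]: "h \<in> borel_measurable borel" and period: "\<And>t. h (k + t) = h t"
  shows "(\<integral>\<^sup>+t. h t * indicator {k + a..<k + b} t \<partial>lborel) =
    (\<integral>\<^sup>+t. h t * indicator {a..<b} t \<partial>lborel)"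
proof -
  have "(\<integral>\<^sup>+t. h t * indicator {k + a..<k + b} t \<partial>lborel) =
      (\<integral>\<^sup>+t. h (k + 1 * t) * indicator {k + a..<k + b} (k + 1 * t) \<partial>lborel)"
    by (subst nn_integral_real_affine[where c=1 and t=k]) auto
  also have "\<dots> = (\<integral>\<^sup>+t. h t * indicator {a..<b} t \<partial>lborel)"
    using period by (intro nn_integral_cong) (auto split: split_indicator)
  finally show ?thesis .
qed

text \<open>Every half-open window of length one is a fundamental domain for the circle. Shifting by
  the integer part of \<open>a\<close> moves the start of the window to \<open>frac a\<close>; the
  piece beyond 1 is then carried back by one period and fills \<open>[0, frac a)\<close>.\<close>

lemma nn_integral_frac_period:
  fixes g :: "real \<Rightarrow> ennreal"
  assumes [measurable]: "g \<in> borel_measurable borel"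
  shows "(\<integral>\<^sup>+t. g (frac t) * indicator {a..<a + 1} t \<partial>lborel) =
    (\<integral>\<^sup>+t. g (frac t) * indicator {0..<1} t \<partial>lborel)"
proof -
  let ?J = "\<lambda>a b. \<integral>\<^sup>+t. g (frac t) * indicator {a..<b} t \<partial>lborel"
  have r: "0 \<le> frac a" "frac a \<le> 1" using frac_lt_1[of a] by auto
  have "?J a (a + 1) = ?J (of_int \<lfloor>a\<rfloor> + frac a) (of_int \<lfloor>a\<rfloor> + (frac a + 1))"
    by (simp add: frac_def)
  also have "\<dots> = ?J (frac a) (frac a + 1)"
    by (rule nn_integral_indicator_translate) auto
  also have "\<dots> = ?J (frac a) 1 + ?J (1 + 0) (1 + frac a)"
    using nn_integral_indicator_split[of "\<lambda>t. g (frac t)" "frac a" 1 "frac a + 1"] r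
    by (simp add: add.commute)
  also have "?J (1 + 0) (1 + frac a) = ?J 0 (frac a)"
    by (rule nn_integral_indicator_translate) (auto simp: frac_1_eq add.commute)
  also have "?J (frac a) 1 + ?J 0 (frac a) = ?J 0 1"
    using nn_integral_indicator_split[of "\<lambda>t. g (frac t)" 0 "frac a" 1] r
    by (simp add: add.commute)
  finally show ?thesis .
qed

text \<open>The half-open interval is the range of \<open>frac\<close>, so it models the reals
  modulo 1. It also makes \<open>u < p\<close> almost sure when \<open>p = 1\<close>.\<close>

abbreviation unit_uniform :: "real measure" where
  "unit_uniform \<equiv> uniform_measure lborel {0..<1}"

lemma prob_space_unit_uniform: "prob_space unit_uniform"
  by (rule prob_space_uniform_measure) auto

interpretation unit_uniform: prob_space unit_uniform
  by (rule prob_space_unit_uniform)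

lemma nn_integral_unit_uniform:
  fixes f :: "real \<Rightarrow> ennreal"
  assumes [measurable]: "f \<in> borel_measurable borel"
  shows "integral\<^sup>N unit_uniform f = (\<integral>\<^sup>+t. f t * indicator {0..<1} t \<partial>lborel)"
  by (subst nn_integral_uniform_measure) (auto simp: divide_ennreal_def)

text \<open>Translation invariance of Haar measure on the circle: \<open>c + u\<close> runs once
  through a window of length one.\<close>

lemma nn_integral_unit_uniform_translate:
  fixes g :: "real \<Rightarrow> ennreal"
  assumes [measurable]: "g \<in> borel_measurable borel"
  shows "(\<integral>\<^sup>+u. g (frac (c + u)) \<partial>unit_uniform) = integral\<^sup>N unit_uniform g"
proof -
  have "(\<integral>\<^sup>+u. g (frac (c + u)) \<partial>unit_uniform) =
      (\<integral>\<^sup>+u. g (frac (c + 1 * u)) * indicator {c..<c + 1} (c + 1 * u) \<partial>lborel)"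
    by (subst nn_integral_unit_uniform) (auto intro!: nn_integral_cong split: split_indicator)
  also have "\<dots> = (\<integral>\<^sup>+t. g (frac t) * indicator {c..<c + 1} t \<partial>lborel)"
    using nn_integral_real_affine[of "\<lambda>t. g (frac t) * indicator {c..<c + 1} t" 1 c] by simp
  also have "\<dots> = (\<integral>\<^sup>+t. g (frac t) * indicator {0..<1} t \<partial>lborel)"
    by (rule nn_integral_frac_period) simp
  also have "\<dots> = integral\<^sup>N unit_uniform g"
    by (subst nn_integral_unit_uniform) (auto intro!: nn_integral_cong split: split_indicator)
  finally show ?thesis .
qed

text \<open>As \<open>u\<close> runs over the unit interval, \<open>c - 2 * u\<close> covers two
  full periods at half density, so the two factors of 2 cancel. This is where the determinant -2
  enters.\<close>

lemma nn_integral_unit_uniform_double: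
  fixes g :: "real \<Rightarrow> ennreal"
  assumes [measurable]: "g \<in> borel_measurable borel"
  shows "(\<integral>\<^sup>+u. g (frac (c - 2 * u)) \<partial>unit_uniform) = integral\<^sup>N unit_uniform g"
proof -
  let ?J = "\<lambda>a b. \<integral>\<^sup>+t. g (frac t) * indicator {a..<b} t \<partial>lborel"
  let ?K = "\<integral>\<^sup>+u. g (frac (c - 2 * u)) \<partial>unit_uniform"
  have "?J (c - 2) c = 2 * (\<integral>\<^sup>+u. g (frac (c + (-2) * u)) * indicator {c - 2..<c} (c + (-2) * u) \<partial>lborel)"
    by (subst nn_integral_real_affine[where c="-2" and t=c]) auto
  \<comment> \<open>The reflection reverses the half-open ends: the left indicator selects
    \<open>(0, 1]\<close> and the right one \<open>[0, 1)\<close>. They differ only at 0 and 1,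
    which are null.\<close>
  also have "(\<integral>\<^sup>+u. g (frac (c + (-2) * u)) * indicator {c - 2..<c} (c + (-2) * u) \<partial>lborel) =
      (\<integral>\<^sup>+u. g (frac (c - 2 * u)) * indicator {0..<1} u \<partial>lborel)"
    using AE_lborel_singleton[of "0::real"] AE_lborel_singleton[of "1::real"]
    by (intro nn_integral_cong_AE) (auto elim!: eventually_elim2 split: split_indicator)
  also have "\<dots> = ?K"
    by (subst nn_integral_unit_uniform) auto
  finally have "2 * ?K = ?J (c - 2) c" by simp
  also have "\<dots> = ?J (c - 2) (c - 2 + 1) + ?J (c - 1) (c - 1 + 1)"
    using nn_integral_indicator_split[of "\<lambda>t. g (frac t)" "c - 2" "c - 1" c] by simp
  also have "\<dots> = 2 * ?J 0 1"
    by (simp only: nn_integral_frac_period[OF assms] mult_2)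
  also have "?J 0 1 = integral\<^sup>N unit_uniform g"
    by (subst nn_integral_unit_uniform) (auto intro!: nn_integral_cong split: split_indicator)
  finally show ?thesis
    by (simp add: ennreal_mult_cancel_left)
qed

section \<open>Independence of the three pairwise sums\<close>

text \<open>With its first premise discharged, this serves as a raw measurability rule for a curried
  function of three arguments.\<close>

lemma measurable_compose_3:
  assumes f: "(\<lambda>(x, y, z). f x y z) \<in> measurable (M1 \<Otimes>\<^sub>M M2 \<Otimes>\<^sub>M M3) K"
    and "a \<in> measurable L M1" "b \<in> measurable L M2" "c \<in> measurable L M3"
  shows "(\<lambda>w. f (a w) (b w) (c w)) \<in> measurable L K"
  using measurable_compose[OF _ f, of "\<lambda>w. (a w, b w, c w)" L] assms(2-4) by simp

interpretation unit_uniform_pair: pair_sigma_finite unit_uniform unit_uniform ..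

text \<open>
  For fixed \<open>u\<close>, the variables \<open>a = u + v\<close> and \<open>b = u + w\<close> are independent and uniform, and
  \<open>v + w = a + b - 2 * u\<close>; integrating over \<open>u\<close> first makes this third sum uniform for given
  \<open>a\<close> and \<open>b\<close>.
\<close>
lemma nn_integral_pairwise_sums:
  fixes g :: "real \<Rightarrow> real \<Rightarrow> real \<Rightarrow> ennreal"
  assumes "(\<lambda>(a, b, c). g a b c) \<in> borel_measurable (borel \<Otimes>\<^sub>M borel \<Otimes>\<^sub>M borel)"
  shows "(\<integral>\<^sup>+u. \<integral>\<^sup>+v. \<integral>\<^sup>+w. g (frac (u + v)) (frac (u + w)) (frac (v + w))
      \<partial>unit_uniform \<partial>unit_uniform \<partial>unit_uniform) =
    (\<integral>\<^sup>+a. \<integral>\<^sup>+b. \<integral>\<^sup>+c. g a b c \<partial>unit_uniform \<partial>unit_uniform \<partial>unit_uniform)"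
    (is "?lhs = ?rhs")
proof -
  note [measurable (raw)] = measurable_compose_3[OF assms]
  have w: "(\<integral>\<^sup>+w. g (frac (u + v)) (frac (u + w)) (frac (v + w)) \<partial>unit_uniform) =
      (\<integral>\<^sup>+b. g (frac (u + v)) b (frac (v - u + b)) \<partial>unit_uniform)" for u v
  proof -
    have "frac (v - u + frac (u + w)) = frac (v + w)" for w
      by simp
    then show ?thesis
      using nn_integral_unit_uniform_translate
        [of "\<lambda>b. g (frac (u + v)) b (frac (v - u + b))" u] by simp
  qed
  have v: "(\<integral>\<^sup>+v. g (frac (u + v)) b (frac (v - u + b)) \<partial>unit_uniform) =
      (\<integral>\<^sup>+a. g a b (frac (a + b - 2 * u)) \<partial>unit_uniform)" for u b
  proof -
    have "frac (frac (u + v) + b - 2 * u) = frac (v - u + b)" for v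
      using frac_add_simps(1)[of "u + v" "b - 2 * u"] by (simp add: algebra_simps)
    moreover have "(\<lambda>a. g a b (frac (a + b - 2 * u))) \<in> borel_measurable borel"
      by measurable
    ultimately show ?thesis
      using nn_integral_unit_uniform_translate[of "\<lambda>a. g a b (frac (a + b - 2 * u))" u]
      by simp
  qed
  have "?lhs = (\<integral>\<^sup>+u. \<integral>\<^sup>+b. \<integral>\<^sup>+v. g (frac (u + v)) b (frac (v - u + b))
      \<partial>unit_uniform \<partial>unit_uniform \<partial>unit_uniform)"
    unfolding w by (rule nn_integral_cong, rule unit_uniform_pair.Fubini') measurable
  also have "\<dots> = (\<integral>\<^sup>+b. \<integral>\<^sup>+u. \<integral>\<^sup>+a. g a b (frac (a + b - 2 * u))
      \<partial>unit_uniform \<partial>unit_uniform \<partial>unit_uniform)"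
    unfolding v by (rule unit_uniform_pair.Fubini') measurable
  also have "\<dots> = (\<integral>\<^sup>+b. \<integral>\<^sup>+a. \<integral>\<^sup>+u. g a b (frac (a + b - 2 * u))
      \<partial>unit_uniform \<partial>unit_uniform \<partial>unit_uniform)"
    by (rule nn_integral_cong, rule unit_uniform_pair.Fubini') measurable
  also have "\<dots> = (\<integral>\<^sup>+b. \<integral>\<^sup>+a. \<integral>\<^sup>+c. g a b c \<partial>unit_uniform \<partial>unit_uniform \<partial>unit_uniform)"
    by (intro nn_integral_cong nn_integral_unit_uniform_double) measurable
  also have "\<dots> = ?rhs"
    by (rule unit_uniform_pair.Fubini') measurable
  finally show ?thesis .
qed

section \<open>Bernoulli variables as thresholds of uniforms\<close>

text \<open>
  The threshold lemma below needs no assumption on \<open>p\<close>, because \<open>bernoulli_pmf\<close> clamps its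
  parameter to the unit interval. This matters when \<open>n < 3\<close>: the padding vertices carry the
  label \<open>undefined\<close>.
\<close>
lemma bernoulli_pmf_clamp: "bernoulli_pmf (max 0 (min 1 p)) = bernoulli_pmf p"
  by (simp add: pmf_eq_iff bernoulli_pmf.rep_eq min_def max_def)

lemma nn_integral_unit_uniform_threshold:
  fixes f :: "bool \<Rightarrow> ennreal"
  shows "(\<integral>\<^sup>+u. f (u < p) \<partial>unit_uniform) = (\<integral>\<^sup>+b. f b \<partial>bernoulli_pmf p)"
proof -
  define q where "q = max 0 (min 1 p)"
  have q: "0 \<le> q" "q \<le> 1" by (auto simp: q_def)
  have "(\<integral>\<^sup>+u. f (u < p) \<partial>unit_uniform) =
      (\<integral>\<^sup>+u. f True * indicator {0..<q} u + f False * indicator {q..<1} u \<partial>lborel)"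
    by (subst nn_integral_unit_uniform)
      (auto intro!: nn_integral_cong simp: q_def split: split_indicator)
  also have "\<dots> = f True * q + f False * (1 - q)"
    using q by (subst nn_integral_add) (auto simp: nn_integral_cmult ennreal_minus)
  also have "\<dots> = (\<integral>\<^sup>+b. f b \<partial>bernoulli_pmf q)"
    using q by (subst nn_integral_bernoulli_pmf) (auto simp: ennreal_minus)
  finally show ?thesis by (simp add: q_def bernoulli_pmf_clamp)
qed

lemma nn_integral_bernoulli_pmf_of_bool:
  "(\<integral>\<^sup>+b. f b \<partial>bernoulli_pmf (of_bool P)) = (f P :: ennreal)"
  by (cases P) auto

section \<open>Separating labels from uniforms in a product of pairs\<close>

text \<open>Regroups independent pairs so that one family of coordinates can be held fixed while the
  other is integrated. The induction peels off coordinate \<open>i\<close>; Fubini then moves its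
  \<open>M i\<close> component past the old \<open>L\<close> coordinates, after which each family
  absorbs its own new coordinate.\<close>

lemma (in product_sigma_finite) nn_integral_PiM_pair:
  assumes "product_sigma_finite L" and "finite I"
    and "f \<in> borel_measurable (\<Pi>\<^sub>M i\<in>I. M i \<Otimes>\<^sub>M L i)"
  shows "(\<integral>\<^sup>+x. f x \<partial>(\<Pi>\<^sub>M i\<in>I. M i \<Otimes>\<^sub>M L i)) =
    (\<integral>\<^sup>+y. \<integral>\<^sup>+u. f (\<lambda>i\<in>I. (y i, u i)) \<partial>PiM I L \<partial>PiM I M)"
  using assms(2,3)
proof (induction I arbitrary: f rule: finite_induct)
  case empty
  then show ?case by (simp add: PiM_empty nn_integral_count_space_finite)
next
  case (insert i I)
  interpret L: product_sigma_finite L by fact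
  interpret pair: product_sigma_finite "\<lambda>i. M i \<Otimes>\<^sub>M L i"
  proof (rule product_sigma_finite.intro)
    fix i
    interpret pair_sigma_finite "M i" "L i" ..
    show "sigma_finite_measure (M i \<Otimes>\<^sub>M L i)" ..
  qed
  note [measurable] = insert.prems
  note fin = insert.hyps
  interpret PL: sigma_finite_measure "PiM I L" by (rule L.sigma_finite) fact
  interpret PL_insert: sigma_finite_measure "PiM (insert i I) L"
    using fin(1) by (intro L.sigma_finite) simp
  interpret P: pair_sigma_finite "PiM I L" "M i" ..
  have [measurable (raw)]:
    "(\<lambda>w. f (\<lambda>j\<in>insert i I. (y w j, u w j))) \<in> borel_measurable K"
    if "y \<in> measurable K (PiM (insert i I) M)" "u \<in> measurable K (PiM (insert i I) L)" for y u K
    by (intro measurable_compose[OF _ insert.prems] measurable_restrict measurable_Pair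
      measurable_compose[OF that(1)] measurable_compose[OF that(2)] measurable_component_singleton)
  have f_upd [measurable (raw)]:
    "(\<lambda>w. f ((x w)(i := z w))) \<in> borel_measurable K"
    if "x \<in> measurable K (\<Pi>\<^sub>M i\<in>I. M i \<Otimes>\<^sub>M L i)" "z \<in> measurable K (M i \<Otimes>\<^sub>M L i)" for x z K
    using that by (intro measurable_compose[OF measurable_fun_upd[where J=I] insert.prems]) auto
  have [measurable (raw)]:
    "(\<lambda>w. \<lambda>j\<in>I. (y w j, u w j)) \<in> measurable K (\<Pi>\<^sub>M i\<in>I. M i \<Otimes>\<^sub>M L i)"
    if "y \<in> measurable K (PiM I M)" "u \<in> measurable K (PiM I L)" for y u K
    by (intro measurable_restrict measurable_Pair
      measurable_compose[OF that(1)] measurable_compose[OF that(2)] measurable_component_singleton)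
  have "(\<integral>\<^sup>+x. f x \<partial>(\<Pi>\<^sub>M i\<in>insert i I. M i \<Otimes>\<^sub>M L i)) =
      (\<integral>\<^sup>+x. \<integral>\<^sup>+z. f (x(i := z)) \<partial>(M i \<Otimes>\<^sub>M L i) \<partial>(\<Pi>\<^sub>M i\<in>I. M i \<Otimes>\<^sub>M L i))"
    by (rule pair.product_nn_integral_insert[OF fin]) fact
  also have "\<dots> = (\<integral>\<^sup>+y. \<integral>\<^sup>+u. \<integral>\<^sup>+z. f ((\<lambda>j\<in>I. (y j, u j))(i := z))
      \<partial>(M i \<Otimes>\<^sub>M L i) \<partial>PiM I L \<partial>PiM I M)"
    by (rule insert.IH) measurable
  also have "\<dots> = (\<integral>\<^sup>+y. \<integral>\<^sup>+u. \<integral>\<^sup>+a. \<integral>\<^sup>+b. f ((\<lambda>j\<in>I. (y j, u j))(i := (a, b)))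
      \<partial>L i \<partial>M i \<partial>PiM I L \<partial>PiM I M)"
  \<comment> \<open>The split is made pointwise because the section in \<open>z\<close> is known to
    be measurable once the tuple assembled from \<open>y\<close> and \<open>u\<close> lies in the
    product space.\<close>
  proof (intro nn_integral_cong)
    fix y u assume "y \<in> space (PiM I M)" "u \<in> space (PiM I L)"
    then have "(\<lambda>j\<in>I. (y j, u j)) \<in> space (\<Pi>\<^sub>M i\<in>I. M i \<Otimes>\<^sub>M L i)"
      by (auto simp: space_PiM space_pair_measure PiE_iff)
    then have "(\<lambda>z. f ((\<lambda>j\<in>I. (y j, u j))(i := z))) \<in> borel_measurable (M i \<Otimes>\<^sub>M L i)"
      by (intro f_upd) auto
    from sigma_finite_measure.nn_integral_fst[OF L.sigma_finite_measures this]
    show "(\<integral>\<^sup>+z. f ((\<lambda>j\<in>I. (y j, u j))(i := z)) \<partial>(M i \<Otimes>\<^sub>M L i)) =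
        (\<integral>\<^sup>+a. \<integral>\<^sup>+b. f ((\<lambda>j\<in>I. (y j, u j))(i := (a, b))) \<partial>L i \<partial>M i)"
      by simp
  qed
  also have "\<dots> = (\<integral>\<^sup>+y. \<integral>\<^sup>+a. \<integral>\<^sup>+u. \<integral>\<^sup>+b. f ((\<lambda>j\<in>I. (y j, u j))(i := (a, b)))
      \<partial>L i \<partial>PiM I L \<partial>M i \<partial>PiM I M)"
    by (rule nn_integral_cong, rule P.Fubini'[symmetric]) measurable
  also have "\<dots> = (\<integral>\<^sup>+y. \<integral>\<^sup>+a. \<integral>\<^sup>+u. \<integral>\<^sup>+b.
        f (\<lambda>j\<in>insert i I. ((y(i := a)) j, (u(i := b)) j))
      \<partial>L i \<partial>PiM I L \<partial>M i \<partial>PiM I M)"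
    using fin by (intro nn_integral_cong arg_cong[where f=f]) auto
  also have "\<dots> = (\<integral>\<^sup>+y. \<integral>\<^sup>+a. \<integral>\<^sup>+u. f (\<lambda>j\<in>insert i I. ((y(i := a)) j, u j))
      \<partial>PiM (insert i I) L \<partial>M i \<partial>PiM I M)"
    by (intro nn_integral_cong L.product_nn_integral_insert[symmetric] fin) measurable
  also have "\<dots> = (\<integral>\<^sup>+y. \<integral>\<^sup>+u. f (\<lambda>j\<in>insert i I. (y j, u j))
      \<partial>PiM (insert i I) L \<partial>PiM (insert i I) M)"
    by (intro product_nn_integral_insert[symmetric] fin) measurable
  finally show ?case .
qed

section \<open>The law of a graph with independent edges\<close>

lemma vertex_pairs_3: "vertex_pairs 3 = {(1, 2), (1, 3), (2, 3)}"
proof -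
  have "{1..3} = {1, 2, 3 :: nat}" by auto
  then show ?thesis unfolding vertex_pairs_def by auto
qed

lemma vertex_pairs_mono: "m \<le> n \<Longrightarrow> vertex_pairs m \<subseteq> vertex_pairs n"
  by (auto simp: vertex_pairs_def)

lemma finite_vertex_pairs: "finite (vertex_pairs n)"
  by (rule finite_subset[of _ "{1..n} \<times> {1..n}"]) (auto simp: vertex_pairs_def)

lemma graph_of_indicators_in: "graph_of_indicators n b \<in> simple_graphs n"
  by (auto simp: graph_of_indicators_def simple_graphs_def)

lemma graph_of_indicators_cong:
  "(\<And>e. e \<in> vertex_pairs n \<Longrightarrow> b e = c e) \<Longrightarrow> graph_of_indicators n b = graph_of_indicators n c"
  unfolding graph_of_indicators_def by (rule Collect_cong) metis

lemma measurable_graph_of_indicators [measurable]: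
  "graph_of_indicators n \<in> measurable (measure_pmf p) (count_space (simple_graphs n))"
  by (auto simp: graph_of_indicators_in measurable_def)

lemma independent_edges_graph_cong:
  assumes "\<And>i j. (i, j) \<in> vertex_pairs n \<Longrightarrow> p i j = q i j"
  shows "independent_edges_graph n p = independent_edges_graph n q"
proof -
  have "Pi_pmf (vertex_pairs n) False (\<lambda>(i, j). bernoulli_pmf (p i j)) =
      Pi_pmf (vertex_pairs n) False (\<lambda>(i, j). bernoulli_pmf (q i j))"
    using assms by (intro Pi_pmf_cong) auto
  then show ?thesis by (simp add: independent_edges_graph_def)
qed

lemma sets_independent_edges_graph [simp, measurable_cong]:
  "sets (independent_edges_graph n p) = sets (count_space (simple_graphs n))"
  by (simp add: independent_edges_graph_def)

lemma prob_space_independent_edges_graph: "prob_space (independent_edges_graph n p)"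
  unfolding independent_edges_graph_def by (rule measure_pmf.prob_space_distr) measurable

text \<open>Expands the probability into finitely many products of Bernoulli masses, from which
  measurability in the edge probabilities can be read off.\<close>

lemma emeasure_independent_edges_graph_sum:
  assumes "A \<subseteq> simple_graphs n"
  shows "emeasure (independent_edges_graph n p) A =
    (\<Sum>b | (\<forall>e. e \<notin> vertex_pairs n \<longrightarrow> \<not> b e) \<and> graph_of_indicators n b \<in> A.
      ennreal (\<Prod>(i, j)\<in>vertex_pairs n. pmf (bernoulli_pmf (p i j)) (b (i, j))))"
    (is "_ = sum ?f ?B")
proof -
  let ?P = "Pi_pmf (vertex_pairs n) False (\<lambda>(i, j). bernoulli_pmf (p i j))"
  have "?B \<subseteq> PiE_dflt (vertex_pairs n) False (\<lambda>_. UNIV)"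
    by (auto simp: PiE_dflt_def)
  then have fin: "finite ?B"
    by (rule finite_subset) (auto intro!: finite_vertex_pairs)
  have "emeasure (independent_edges_graph n p) A = emeasure ?P (graph_of_indicators n -` A)"
    unfolding independent_edges_graph_def using assms
    by (subst emeasure_distr) (auto simp: graph_of_indicators_in)
  \<comment> \<open>The default value \<open>False\<close> confines the law to indicators that
    vanish off \<open>vertex_pairs n\<close>, and there are only finitely many of these.\<close>
  also have "\<dots> = emeasure ?P ?B"
    by (intro emeasure_eq_AE)
      (auto simp: AE_measure_pmf_iff set_pmf_eq pmf_Pi finite_vertex_pairs split: if_splits)
  also have "\<dots> = sum ?f ?B"
    using fin by (subst emeasure_measure_pmf_finite)
      (auto intro!: sum.cong prod.cong arg_cong[where f=ennreal]
        simp: pmf_Pi finite_vertex_pairs sum_ennreal[symmetric] prod_nonneg simp del: sum_ennreal)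
  finally show ?thesis .
qed

text \<open>Makes the conditional law a Giry kernel. The premise is confined to
  \<open>vertex_pairs n\<close> because coordinate projections are at hand only for indices in
  \<open>{1..n}\<close>.\<close>

lemma measurable_independent_edges_graph [measurable]:
  assumes [measurable]: "\<And>i j. (i, j) \<in> vertex_pairs n \<Longrightarrow> (\<lambda>x. p x i j) \<in> borel_measurable M"
  shows "(\<lambda>x. independent_edges_graph n (p x)) \<in>
    measurable M (subprob_algebra (count_space (simple_graphs n)))"
proof (rule measurable_subprob_algebra)
  fix A assume "A \<in> sets (count_space (simple_graphs n))"
  then have A: "A \<subseteq> simple_graphs n" by simp
  have "(\<lambda>x. pmf (bernoulli_pmf (p x i j)) b) \<in> borel_measurable M"
    if "(i, j) \<in> vertex_pairs n" for i j b
    using that unfolding bernoulli_pmf.rep_eq by (cases b) auto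
  then show "(\<lambda>x. emeasure (independent_edges_graph n (p x)) A) \<in> borel_measurable M"
    unfolding emeasure_independent_edges_graph_sum[OF A]
    by (intro borel_measurable_sum measurable_compose[OF _ measurable_ennreal]
      borel_measurable_prod) auto
qed (auto intro: prob_space_imp_subprob_space prob_space_independent_edges_graph)

text \<open>The order of the updates is the one produced by unfolding \<open>Pi_pmf\<close> edge by
  edge, and the base function is its default value.\<close>

definition triangle_indicators :: "bool \<Rightarrow> bool \<Rightarrow> bool \<Rightarrow> nat \<times> nat \<Rightarrow> bool" where
  "triangle_indicators a b c = (\<lambda>_. False)((2, 3) := c, (1, 3) := b, (1, 2) := a)"

text \<open>For \<open>n < 3\<close> the law is a marginal of the one on three vertices:
  \<open>graph_of_indicators n\<close> ignores the surplus edges, which integrate out. One formula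
  thus serves all three values of \<open>n\<close>.\<close>

lemma emeasure_independent_edges_graph:
  assumes "n \<le> 3" and "A \<subseteq> simple_graphs n"
  shows "emeasure (independent_edges_graph n p) A =
    (\<integral>\<^sup>+a. \<integral>\<^sup>+b. \<integral>\<^sup>+c. indicator A (graph_of_indicators n (triangle_indicators a b c))
      \<partial>bernoulli_pmf (p 2 3) \<partial>bernoulli_pmf (p 1 3) \<partial>bernoulli_pmf (p 1 2))"
proof -
  let ?q = "\<lambda>(i, j). bernoulli_pmf (p i j)"
  have P3: "Pi_pmf (vertex_pairs 3) False ?q =
    bernoulli_pmf (p 1 2) \<bind> (\<lambda>a. bernoulli_pmf (p 1 3) \<bind> (\<lambda>b. bernoulli_pmf (p 2 3) \<bind>
      (\<lambda>c. return_pmf (triangle_indicators a b c))))"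
    by (simp add: vertex_pairs_3 Pi_pmf_insert' triangle_indicators_def
      bind_assoc_pmf bind_return_pmf)
  have "emeasure (independent_edges_graph n p) A =
      (\<integral>\<^sup>+G. indicator A G \<partial>independent_edges_graph n p)"
    using assms(2) by simp
  also have "\<dots> = (\<integral>\<^sup>+b. indicator A (graph_of_indicators n b) \<partial>Pi_pmf (vertex_pairs n) False ?q)"
    unfolding independent_edges_graph_def by (subst nn_integral_distr) (auto simp: graph_of_indicators_in)
  also have "\<dots> = (\<integral>\<^sup>+b. indicator A (graph_of_indicators n b) \<partial>Pi_pmf (vertex_pairs 3) False ?q)"
    unfolding Pi_pmf_subset[OF finite_vertex_pairs vertex_pairs_mono[OF assms(1)]]
      nn_integral_map_pmf
    by (intro nn_integral_cong arg_cong[where f="indicator A"] graph_of_indicators_cong) auto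
  also have "\<dots> = (\<integral>\<^sup>+a. \<integral>\<^sup>+b. \<integral>\<^sup>+c. indicator A (graph_of_indicators n (triangle_indicators a b c))
      \<partial>bernoulli_pmf (p 2 3) \<partial>bernoulli_pmf (p 1 3) \<partial>bernoulli_pmf (p 1 2))"
    by (simp add: P3)
  finally show ?thesis .
qed

section \<open>Integrals over finite powers of a measure\<close>

lemma nn_integral_PiM_3:
  fixes f :: "'a \<Rightarrow> 'a \<Rightarrow> 'a \<Rightarrow> ennreal"
  assumes "sigma_finite_measure M"
    and [measurable]: "(\<lambda>(x, y, z). f x y z) \<in> borel_measurable (M \<Otimes>\<^sub>M M \<Otimes>\<^sub>M M)"
  shows "(\<integral>\<^sup>+u. f (u 1) (u 2) (u 3) \<partial>(\<Pi>\<^sub>M i\<in>{1..3::nat}. M)) =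
    (\<integral>\<^sup>+x. \<integral>\<^sup>+y. \<integral>\<^sup>+z. f x y z \<partial>M \<partial>M \<partial>M)"
proof -
  interpret M: product_sigma_finite "\<lambda>_::nat. M"
    using assms(1) by (rule product_sigma_finite.intro)
  interpret sigma_finite_measure M by fact
  note [measurable (raw)] = measurable_compose_3[OF assms(2)]
  have eq: "{1..3} = insert 3 (insert 2 {1::nat})" by auto
  have "(\<integral>\<^sup>+u. f (u 1) (u 2) (u 3) \<partial>(\<Pi>\<^sub>M i\<in>{1..3::nat}. M)) =
      (\<integral>\<^sup>+u. \<integral>\<^sup>+z. f (u 1) (u 2) z \<partial>M \<partial>(\<Pi>\<^sub>M i\<in>insert 2 {1::nat}. M))"
    unfolding eq by (subst M.product_nn_integral_insert) (auto, measurable)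
  also have "\<dots> = (\<integral>\<^sup>+u. \<integral>\<^sup>+y. \<integral>\<^sup>+z. f (u 1) y z \<partial>M \<partial>M \<partial>(\<Pi>\<^sub>M i\<in>{1::nat}. M))"
    by (subst M.product_nn_integral_insert) (simp_all, measurable)
  also have "\<dots> = (\<integral>\<^sup>+x. \<integral>\<^sup>+y. \<integral>\<^sup>+z. f x y z \<partial>M \<partial>M \<partial>M)"
    by (rule M.product_nn_integral_singleton) measurable
  finally show ?thesis .
qed

text \<open>Marginalisation: the coordinates outside \<open>J\<close> have total mass one. It serves
  to pad the uniforms up to three vertices.\<close>

lemma nn_integral_PiM_subset:
  assumes "prob_space M" "J \<subseteq> K" "finite K"
    and [measurable]: "f \<in> borel_measurable (\<Pi>\<^sub>M i\<in>J. M)"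
  shows "(\<integral>\<^sup>+u. f u \<partial>(\<Pi>\<^sub>M i\<in>J. M)) = (\<integral>\<^sup>+u. f (restrict u J) \<partial>(\<Pi>\<^sub>M i\<in>K. M))"
proof -
  interpret product_prob_space "\<lambda>_. M"
    using assms(1) by (rule product_prob_spaceI)
  show ?thesis
    using assms(2) by (subst distr_restrict[OF assms(2,3)], subst nn_integral_distr)
      (auto intro!: measurable_restrict_subset)
qed

section \<open>The random graph as a mixture over the labels\<close>

lemma symmetric_kernel_measurable:
  assumes "symmetric_kernel M \<phi>" and [measurable]: "f \<in> measurable L M" "g \<in> measurable L M"
  shows "(\<lambda>x. \<phi> (f x) (g x)) \<in> borel_measurable L"
proof -
  have "(\<lambda>(x, y). \<phi> x y) \<in> borel_measurable (M \<Otimes>\<^sub>M M)"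
    using assms(1) by (simp add: symmetric_kernel_def)
  from measurable_compose[OF _ this, of "\<lambda>x. (f x, g x)" L] show ?thesis
    by simp
qed

lemma measurable_vertex_edge_kernel:
  assumes "symmetric_kernel M \<phi>"
  shows "(\<lambda>x. independent_edges_graph n (\<lambda>i j. \<phi> (x i) (x j))) \<in>
    measurable (\<Pi>\<^sub>M i\<in>{1..n}. M) (subprob_algebra (count_space (simple_graphs n)))"
  by (intro measurable_independent_edges_graph symmetric_kernel_measurable[OF assms]
      measurable_component_singleton) (auto simp: vertex_pairs_def)

text \<open>The Giry \<open>bind\<close> treats an empty space as a special case, so its rules ask
  for nonemptiness.\<close>

lemma space_PiM_prob_space_nonempty: "prob_space M \<Longrightarrow> space (\<Pi>\<^sub>M i\<in>I. M) \<noteq> {}"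
  by (intro prob_space.not_empty prob_space_PiM)

lemma sets_vertex_edge_random_graph:
  "prob_space M \<Longrightarrow> sets (vertex_edge_random_graph n M \<phi>) = sets (count_space (simple_graphs n))"
  unfolding vertex_edge_random_graph_def
  by (intro sets_bind sets_independent_edges_graph space_PiM_prob_space_nonempty)

lemma emeasure_vertex_edge_random_graph:
  assumes "prob_space M" "symmetric_kernel M \<phi>" "A \<subseteq> simple_graphs n"
  shows "emeasure (vertex_edge_random_graph n M \<phi>) A =
    (\<integral>\<^sup>+x. emeasure (independent_edges_graph n (\<lambda>i j. \<phi> (x i) (x j))) A \<partial>(\<Pi>\<^sub>M i\<in>{1..n}. M))"
  unfolding vertex_edge_random_graph_def using assms
  by (intro emeasure_bind[OF space_PiM_prob_space_nonempty measurable_vertex_edge_kernel]) auto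

section \<open>The threshold graph for fixed labels\<close>

text \<open>The heart of the argument, conditionally on the labels: \<open>p\<close> holds the
  prescribed edge probabilities, and averaging the deterministic graph over the uniforms makes the
  edges independent, because the pairwise sums are.\<close>

lemma nn_integral_threshold_graph:
  assumes "n \<le> 3" and A: "A \<subseteq> simple_graphs n"
  shows "(\<integral>\<^sup>+u. emeasure (independent_edges_graph n
      (\<lambda>i j. of_bool (frac (u i + u j) < p i j))) A \<partial>(\<Pi>\<^sub>M i\<in>{1..n}. unit_uniform)) =
    emeasure (independent_edges_graph n p) A" (is "?lhs = _")
proof -
  define F where "F a b c = (indicator A (graph_of_indicators n (triangle_indicators a b c)) :: ennreal)"
    for a b c
  let ?K = "\<lambda>u. independent_edges_graph n (\<lambda>i j. of_bool (frac (u i + u j) < p i j))"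
  have K: "?K \<in> measurable (\<Pi>\<^sub>M i\<in>{1..n}. unit_uniform)
      (subprob_algebra (count_space (simple_graphs n)))"
  proof (rule measurable_independent_edges_graph)
    fix i j assume "(i, j) \<in> vertex_pairs n"
    then have [measurable]: "i \<in> {1..n}" "j \<in> {1..n}" by (auto simp: vertex_pairs_def)
    show "(\<lambda>u. of_bool (frac (u i + u j) < p i j) :: real) \<in>
        borel_measurable (\<Pi>\<^sub>M i\<in>{1..n}. unit_uniform)"
      by measurable
  qed
  have "?lhs = (\<integral>\<^sup>+u. emeasure (?K (restrict u {1..n})) A \<partial>(\<Pi>\<^sub>M i\<in>{1..3::nat}. unit_uniform))"
    using assms by (intro nn_integral_PiM_subset prob_space_unit_uniform
      measurable_compose[OF K measurable_emeasure_subprob_algebra]) auto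
  also have "\<dots> = (\<integral>\<^sup>+u. emeasure (?K u) A \<partial>(\<Pi>\<^sub>M i\<in>{1..3::nat}. unit_uniform))"
    by (intro nn_integral_cong arg_cong[where f="\<lambda>N. emeasure N A"] independent_edges_graph_cong)
      (auto simp: vertex_pairs_def)
  \<comment> \<open>A Bernoulli variable with parameter 0 or 1 is constant, so the three edge
    integrals collapse to evaluation at the threshold conditions.\<close>
  also have "\<dots> = (\<integral>\<^sup>+u. F (frac (u 1 + u 2) < p 1 2) (frac (u 1 + u 3) < p 1 3)
      (frac (u 2 + u 3) < p 2 3) \<partial>(\<Pi>\<^sub>M i\<in>{1..3::nat}. unit_uniform))"
    by (simp add: emeasure_independent_edges_graph[OF assms] nn_integral_bernoulli_pmf_of_bool F_def)
  also have "\<dots> = (\<integral>\<^sup>+u. \<integral>\<^sup>+v. \<integral>\<^sup>+w. F (frac (u + v) < p 1 2) (frac (u + w) < p 1 3)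
      (frac (v + w) < p 2 3) \<partial>unit_uniform \<partial>unit_uniform \<partial>unit_uniform)"
    by (intro nn_integral_PiM_3) (simp_all add: unit_uniform.sigma_finite_measure_axioms)
  also have "\<dots> = (\<integral>\<^sup>+u. \<integral>\<^sup>+v. \<integral>\<^sup>+w. F (u < p 1 2) (v < p 1 3) (w < p 2 3)
      \<partial>unit_uniform \<partial>unit_uniform \<partial>unit_uniform)"
    by (rule nn_integral_pairwise_sums) measurable
  \<comment> \<open>Each instance of the threshold lemma names the integrand that remains once the
    variables further inside have been integrated.\<close>
  also have "\<dots> = emeasure (independent_edges_graph n p) A"
    by (simp add: emeasure_independent_edges_graph[OF assms] F_def
      nn_integral_unit_uniform_threshold[where f="\<lambda>c. F _ _ c", unfolded F_def]
      nn_integral_unit_uniform_threshold[where f="\<lambda>b. \<integral>\<^sup>+c. F _ b c \<partial>_", unfolded F_def]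
      nn_integral_unit_uniform_threshold[where f="\<lambda>a. \<integral>\<^sup>+b. \<integral>\<^sup>+c. F a b c \<partial>_ \<partial>_", unfolded F_def])
  finally show ?thesis .
qed

theorem theorem4p4:
  fixes n :: nat and M :: "'a measure" and \<phi> :: "'a \<Rightarrow> 'a \<Rightarrow> real"
  assumes "1 \<le> n" and "n \<le> 3"
    and "prob_space M"
    and "symmetric_kernel M \<phi>"
    and "\<forall>x\<in>space M. \<forall>y\<in>space M. \<phi> x y \<in> {0..1}"
  shows "\<exists>(N :: ('a \<times> real) measure) (\<psi> :: 'a \<times> real \<Rightarrow> 'a \<times> real \<Rightarrow> real).
           prob_space N \<and> symmetric_kernel N \<psi> \<and>
           (\<forall>x\<in>space N. \<forall>y\<in>space N. \<psi> x y \<in> {0, 1}) \<and>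
           vertex_edge_random_graph n M \<phi> = vertex_edge_random_graph n N \<psi>"
proof -
  define N where "N = M \<Otimes>\<^sub>M unit_uniform"
  define \<psi> :: "'a \<times> real \<Rightarrow> 'a \<times> real \<Rightarrow> real" where
    "\<psi> x y = of_bool (frac (snd x + snd y) < \<phi> (fst x) (fst y))" for x y
  interpret M: prob_space M by fact
  interpret MU: pair_prob_space M unit_uniform ..
  interpret PM: product_sigma_finite "\<lambda>_::nat. M" ..
  have N: "prob_space N" unfolding N_def by (rule MU.P.prob_space_axioms)
  have \<psi>: "symmetric_kernel N \<psi>"
  proof -
    have [measurable]: "(\<lambda>z. \<phi> (fst (fst z)) (fst (snd z))) \<in> borel_measurable (N \<Otimes>\<^sub>M N)"
      unfolding N_def by (intro symmetric_kernel_measurable[OF assms(4)]) measurable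
    have [measurable]: "(\<lambda>z. frac (snd (fst z) + snd (snd z))) \<in> borel_measurable (N \<Otimes>\<^sub>M N)"
      unfolding N_def by measurable
    have "(\<lambda>(x, y). \<psi> x y) \<in> borel_measurable (N \<Otimes>\<^sub>M N)"
      unfolding \<psi>_def case_prod_beta by measurable
    moreover have "\<forall>x\<in>space N. \<forall>y\<in>space N. \<psi> x y = \<psi> y x"
      using assms(4)
      by (auto simp: symmetric_kernel_def \<psi>_def N_def space_pair_measure add.commute)
    ultimately show ?thesis by (simp add: symmetric_kernel_def)
  qed
  have "vertex_edge_random_graph n M \<phi> = vertex_edge_random_graph n N \<psi>"
  proof (rule measure_eqI)
    show "sets (vertex_edge_random_graph n M \<phi>) = sets (vertex_edge_random_graph n N \<psi>)"
      by (simp add: sets_vertex_edge_random_graph assms(3) N)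
  next
    fix A assume "A \<in> sets (vertex_edge_random_graph n M \<phi>)"
    then have A: "A \<subseteq> simple_graphs n"
      by (simp add: sets_vertex_edge_random_graph assms(3))
    let ?K = "\<lambda>x. emeasure (independent_edges_graph n (\<lambda>i j. \<psi> (x i) (x j))) A"
    have "?K \<in> borel_measurable (\<Pi>\<^sub>M i\<in>{1..n}. N)"
      using A by (intro measurable_compose[OF measurable_vertex_edge_kernel[OF \<psi>]]
        measurable_emeasure_subprob_algebra) simp
    \<comment> \<open>Drawing label-uniform pairs amounts to drawing all labels \<open>y\<close>
      first and all uniforms \<open>u\<close> afterwards, so the inner integral has \<open>y\<close>
      fixed.\<close>
    then have "emeasure (vertex_edge_random_graph n N \<psi>) A =
        (\<integral>\<^sup>+y. \<integral>\<^sup>+u. ?K (\<lambda>i\<in>{1..n}. (y i, u i))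
          \<partial>(\<Pi>\<^sub>M i\<in>{1..n}. unit_uniform) \<partial>(\<Pi>\<^sub>M i\<in>{1..n}. M))"
      unfolding emeasure_vertex_edge_random_graph[OF N \<psi> A] unfolding N_def
      by (intro PM.nn_integral_PiM_pair product_sigma_finite.intro
        unit_uniform.sigma_finite_measure_axioms) auto
    also have "\<dots> = (\<integral>\<^sup>+y. \<integral>\<^sup>+u. emeasure (independent_edges_graph n
          (\<lambda>i j. of_bool (frac (u i + u j) < \<phi> (y i) (y j)))) A
          \<partial>(\<Pi>\<^sub>M i\<in>{1..n}. unit_uniform) \<partial>(\<Pi>\<^sub>M i\<in>{1..n}. M))"
      by (intro nn_integral_cong arg_cong[where f="\<lambda>N. emeasure N A"] independent_edges_graph_cong)
        (auto simp: vertex_pairs_def \<psi>_def)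
    \<comment> \<open>For fixed \<open>y\<close>, the inner integral is the threshold graph with
      \<open>p i j = \<phi> (y i) (y j)\<close>; what remains is the mixture over the labels
      alone.\<close>
    also have "\<dots> = emeasure (vertex_edge_random_graph n M \<phi>) A"
      unfolding nn_integral_threshold_graph[OF assms(2) A]
      by (rule emeasure_vertex_edge_random_graph[OF assms(3,4) A, symmetric])
    finally show "emeasure (vertex_edge_random_graph n M \<phi>) A =
      emeasure (vertex_edge_random_graph n N \<psi>) A" ..
  qed
  moreover have "\<forall>x\<in>space N. \<forall>y\<in>space N. \<psi> x y \<in> {0, 1}"
    by (simp add: \<psi>_def)
  ultimately show ?thesis using N \<psi> by blast
qed

end
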